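(* Let $n\ge 2$, $d\ge 1$ and $1\le s\le \binom{d+n-1}{d}$ be integers. Let $\ell_1,\dots,\ell_s\in[S]_1$ be general linear forms, let $F_s=\ell_1^d+\cdots+\ell_s^d\in[S]_d$, and let $A_{F_s}=R/\operatorname{Ann}_R(F_s)$ be the Artinian Gorenstein graded $\mathbb{K}$-algebra of socle degree $d$ with Macaulay dual generator $F_s$. Then $A_{F_s}$ has the strong Lefschetz property.
   Context: $\mathbb{K}$ is an algebraically closed field of characteristic zero, $R=\mathbb{K}[x_1,\dots,x_n]$ and $S=\mathbb{K}[X_1,\dots,X_n]$ with the standard grading; $[M]_k$ denotes the degree-$k$ component. $R$ acts on $S$ by differentiation, $x_i=\partial/\partial X_i$; $\operatorname{Ann}_R(F)=\{p\in R : p(\partial/\partial X_1,\dots,\partial/\partial X_n)\circ F=0\}$. If $F\neq 0$ is homogeneous of degree $d$, then $R/\operatorname{Ann}_R(F)$ is Artinian Gorenstein of socle degree $d$ and $F$ is called its Macaulay dual generator. A standard graded Artinian $\mathbb{K}$-algebra $A$ has the strong Lefschetz property (SLP) if there is a linear form $\ell\in[A]_1$ such that for all integers $i\ge 0$ and $k\ge 1$ the multiplication map $\times\ell^k:[A]_i\to[A]_{i+k}$ has maximal rank, i.e. is injective or surjective. "General": writing $\ell_i=a_{i,1}X_1+\cdots+a_{i,n}X_n$, a statement holds for general linear forms $\ell_1,\dots,\ell_s$ if there is a nonempty (dense) Zariski open subset $U\subset \mathbb{K}^{ns}$ such that it holds whenever $(a_{1,1},\dots,a_{1,n},\dots,a_{s,1},\dots,a_{s,n})\in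 U$. *)

theory Defs
  imports
    "HOL-Library.Poly_Mapping"
    "HOL-Library.FuncSet"
    "HOL-Computational_Algebra.Polynomial"
    "HOL-Algebra.QuotRing"
begin

section \<open>Multivariate polynomials\<close>

text \<open>
  A monomial is a finitely supported exponent vector, and a polynomial is a finitely
  supported family of coefficients indexed by monomials. The product of the type
  \<^typ>\<open>('v \<Rightarrow>\<^sub>0 nat) \<Rightarrow>\<^sub>0 'k\<close> is the convolution, that is, the usual product of
  polynomials. The variables range over the whole type \<^typ>\<open>'v\<close>, so a polynomial ring
  in a given set of variables is a subring.
\<close>

type_synonym ('v, 'k) mpoly = "('v \<Rightarrow>\<^sub>0 nat) \<Rightarrow>\<^sub>0 'k"

definition mpolys :: "'v set \<Rightarrow> ('v, 'k::zero) mpoly set" where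
  "mpolys V = {p. \<forall>m \<in> Poly_Mapping.keys p. Poly_Mapping.keys m \<subseteq> V}"

definition mpoly_ring :: "'v set \<Rightarrow> ('v, 'k::comm_ring_1) mpoly ring" where
  "mpoly_ring V = \<lparr>carrier = mpolys V, mult = (*), one = 1, zero = 0, add = (+)\<rparr>"

definition mvar :: "'v \<Rightarrow> ('v, 'k::comm_ring_1) mpoly" where
  "mvar v = Poly_Mapping.single (Poly_Mapping.single v 1) 1"

definition mconst :: "'k \<Rightarrow> ('v, 'k::comm_ring_1) mpoly" where
  "mconst c = Poly_Mapping.single 0 c"

definition mdeg :: "('v \<Rightarrow>\<^sub>0 nat) \<Rightarrow> nat" where
  "mdeg m = (\<Sum>v \<in> Poly_Mapping.keys m. Poly_Mapping.lookup m v)"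

definition homogeneous_part :: "'v set \<Rightarrow> nat \<Rightarrow> ('v, 'k::zero) mpoly set" where
  "homogeneous_part V k = {p \<in> mpolys V. \<forall>m \<in> Poly_Mapping.keys p. mdeg m = k}"

definition mpoly_eval :: "('v \<Rightarrow> 'k) \<Rightarrow> ('v, 'k::comm_ring_1) mpoly \<Rightarrow> 'k" where
  "mpoly_eval a p = (\<Sum>m \<in> Poly_Mapping.keys p. Poly_Mapping.lookup p m *
     (\<Prod>v \<in> Poly_Mapping.keys m. a v ^ Poly_Mapping.lookup m v))"


section \<open>Zariski topology on an affine space and general points\<close>

text \<open>
  The affine space with coordinates indexed by \<^term>\<open>I\<close> consists of the extensional
  functions \<^term>\<open>I \<rightarrow>\<^sub>E UNIV\<close>, so that points correspond exactly to coordinate vectors.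
\<close>

definition zariski_closed :: "'v set \<Rightarrow> ('v \<Rightarrow> 'k::field) set \<Rightarrow> bool" where
  "zariski_closed I Z \<longleftrightarrow>
     (\<exists>P \<subseteq> mpolys I. Z = {a \<in> I \<rightarrow>\<^sub>E UNIV. \<forall>p \<in> P. mpoly_eval a p = 0})"

definition zariski_open :: "'v set \<Rightarrow> ('v \<Rightarrow> 'k::field) set \<Rightarrow> bool" where
  "zariski_open I U \<longleftrightarrow> U \<subseteq> (I \<rightarrow>\<^sub>E UNIV) \<and> zariski_closed I ((I \<rightarrow>\<^sub>E UNIV) - U)"

text \<open>
  Over an infinite field a nonempty Zariski open subset of an affine space is
  automatically dense, so only nonemptiness is required.
\<close>

definition holds_for_general :: "'v set \<Rightarrow> (('v \<Rightarrow> 'k::field) \<Rightarrow> bool) \<Rightarrow> bool" where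
  "holds_for_general I Q \<longleftrightarrow> (\<exists>U. zariski_open I U \<and> U \<noteq> {} \<and> (\<forall>a \<in> U. Q a))"


section \<open>The action by differentiation and annihilators\<close>

text \<open>
  The summands with \<^term>\<open>Poly_Mapping.lookup m v = 0\<close> vanish, so the truncated
  subtraction of exponent vectors is harmless.
\<close>

definition mpderiv :: "'v \<Rightarrow> ('v, 'k::comm_ring_1) mpoly \<Rightarrow> ('v, 'k) mpoly" where
  "mpderiv v F = (\<Sum>m \<in> Poly_Mapping.keys F.
     Poly_Mapping.single (m - Poly_Mapping.single v 1)
       (of_nat (Poly_Mapping.lookup m v) * Poly_Mapping.lookup F m))"

text \<open>
  A monomial acts as the composition of the corresponding partial derivatives. These
  commute, so the order of composition is immaterial.
\<close>

definition monom_diff :: "(nat \<Rightarrow>\<^sub>0 nat) \<Rightarrow> (nat, 'k::comm_ring_1) mpoly \<Rightarrow> (nat, 'k) mpoly" where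
  "monom_diff m F = foldr (\<lambda>v. mpderiv v ^^ Poly_Mapping.lookup m v)
     (sorted_list_of_set (Poly_Mapping.keys m)) F"

definition mpoly_diff :: "(nat, 'k::comm_ring_1) mpoly \<Rightarrow> (nat, 'k) mpoly \<Rightarrow> (nat, 'k) mpoly" where
  "mpoly_diff p F =
     (\<Sum>m \<in> Poly_Mapping.keys p. mconst (Poly_Mapping.lookup p m) * monom_diff m F)"

definition Ann :: "nat \<Rightarrow> (nat, 'k::comm_ring_1) mpoly \<Rightarrow> (nat, 'k) mpoly set" where
  "Ann n F = {p \<in> mpolys {..<n}. mpoly_diff p F = 0}"


section \<open>Macaulay dual algebras and the strong Lefschetz property\<close>

definition macaulay_algebra :: "nat \<Rightarrow> (nat, 'k::comm_ring_1) mpoly \<Rightarrow> (nat, 'k) mpoly set ring" where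
  "macaulay_algebra n F = mpoly_ring {..<n} Quot Ann n F"

definition macaulay_part ::
  "nat \<Rightarrow> (nat, 'k::comm_ring_1) mpoly \<Rightarrow> nat \<Rightarrow> (nat, 'k) mpoly set set" where
  "macaulay_part n F k =
     (\<lambda>p. Ann n F +>\<^bsub>mpoly_ring {..<n}\<^esub> p) ` homogeneous_part {..<n} k"

text \<open>
  \<^term>\<open>G k\<close> is the degree \<^term>\<open>k\<close> component of the standard graded
  Artinian algebra \<^term>\<open>A\<close>.
\<close>

definition strong_lefschetz :: "('a, 'b) ring_scheme \<Rightarrow> (nat \<Rightarrow> 'a set) \<Rightarrow> bool" where
  "strong_lefschetz A G \<longleftrightarrow>
     (\<exists>l \<in> G 1. \<forall>i k::nat. 1 \<le> k \<longrightarrow>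
        inj_on (\<lambda>x. (l [^]\<^bsub>A\<^esub> k) \<otimes>\<^bsub>A\<^esub> x) (G i) \<or>
        (\<lambda>x. (l [^]\<^bsub>A\<^esub> k) \<otimes>\<^bsub>A\<^esub> x) ` G i = G (i + k))"


section \<open>Sums of powers of linear forms\<close>

definition linear_form :: "nat \<Rightarrow> (nat \<Rightarrow> 'k) \<Rightarrow> (nat, 'k::comm_ring_1) mpoly" where
  "linear_form n c = (\<Sum>j<n. mconst (c j) * mvar j)"

definition power_sum_form ::
  "nat \<Rightarrow> nat \<Rightarrow> nat \<Rightarrow> (nat \<times> nat \<Rightarrow> 'k) \<Rightarrow> (nat, 'k::comm_ring_1) mpoly" where
  "power_sum_form n d s a = (\<Sum>i<s. linear_form n (\<lambda>j. a (i, j)) ^ d)"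

end

theory Submission
  imports Defs "Jordan_Normal_Form.Determinant"
begin

text \<open>
  Let $a_j$ be the coefficient vector of $\ell_j$. By the multinomial theorem, a form $p$ of
  degree $i \le d$ annihilates $F = \sum_j \ell_j^d$ if and only if $\sum_j q(a_j)\, p(a_j) = 0$ for all
  forms $q$ of degree $d - i$ (\<open>homogeneous_Ann_iff\<close>). As $[A]_i = 0$ for $i > d$, the strong
  Lefschetz property follows once $\times x^{d-2i} : [A]_i \to [A]_{d-i}$ is bijective for all
  $2i \le d$, with the first variable $x = x_0$ as Lefschetz element
  (\<open>strong_lefschetz_if_middle_bijective\<close>).

  Put $c_j = x(a_j)^{d-2i}$. Bijectivity is a consequence of the solvability of the normal equations:
  for all $w_1, \ldots, w_s$ there is a form $p$ of degree $i$ such that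
  $\sum_j q(a_j)\,(c_j\, p(a_j) - w_j) = 0$ for all forms $q$ of degree $i$
  (\<open>strong_lefschetz_if_normal_equations\<close>).

  Let $N$ be the number of monomials of degree $i$, choose $\min(s, N)$ of them, and let $V$ be the
  matrix of their values at the points. If the Gram matrix $V^T D V$, $D = \mathrm{diag}(c)$, is
  invertible, the normal equations are solvable (\<open>normal_equations_if_gram_nonsingular\<close>). Its
  determinant is a polynomial in the coordinates of the $a_j$, so it remains to exhibit one point
  where it does not vanish for any of the finitely many $i$. Take $a_j = (y_0^j, \ldots, y_{n-1}^j)$ for
  distinct primes $y_v$. The monomials then have distinct values $y^m$ at $y$, and $V$ is a
  Vandermonde matrix with independent columns. Moreover, all entries are integers and the weights
  are positive, so over the reals $V^T D V$ is positive definite; its determinant is a nonzero integer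
  and stays nonzero in characteristic zero (\<open>generic_normal_equations\<close>).
\<close>

abbreviation lookup :: "('a \<Rightarrow>\<^sub>0 'b::zero) \<Rightarrow> 'a \<Rightarrow> 'b" where
  "lookup \<equiv> Poly_Mapping.lookup"

abbreviation keys :: "('a \<Rightarrow>\<^sub>0 'b::zero) \<Rightarrow> 'a set" where
  "keys \<equiv> Poly_Mapping.keys"

abbreviation single :: "'a \<Rightarrow> 'b \<Rightarrow> 'a \<Rightarrow>\<^sub>0 'b::zero" where
  "single \<equiv> Poly_Mapping.single"

section \<open>Linear functionals on polynomials\<close>

lemma sum_of_monomials: "(\<Sum>m\<in>keys p. single m (lookup p m)) = p"
  by (rule poly_mapping_eqI)
    (auto simp: lookup_sum lookup_single when_def in_keys_iff)

text \<open>
  Evaluation at a point and the pairing that defines the annihilator are both of this shape: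
  they are determined linearly by their values \<^term>\<open>g\<close> on monomials.
\<close>
definition linext :: "('m \<Rightarrow> 'k) \<Rightarrow> ('m \<Rightarrow>\<^sub>0 'k::comm_ring_1) \<Rightarrow> 'k" where
  "linext g p = (\<Sum>m\<in>keys p. lookup p m * g m)"

lemma linext_superset:
  assumes "finite M" "keys p \<subseteq> M"
  shows "linext g p = (\<Sum>m\<in>M. lookup p m * g m)"
  unfolding linext_def using assms
  by (intro sum.mono_neutral_left) (auto simp: in_keys_iff)

lemma linext_zero [simp]: "linext g 0 = 0"
  by (simp add: linext_def)

lemma linext_single [simp]: "linext g (single m c) = c * g m"
  by (simp add: linext_def)

lemma linext_add: "linext g (p + q) = linext g p + linext g q"
proof -
  let ?M = "keys p \<union> keys q"
  have "keys (p + q) \<subseteq> ?M" by (rule Poly_Mapping.keys_add)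
  then show ?thesis
    by (simp add: linext_superset[where M = ?M] lookup_add sum.distrib algebra_simps)
qed

lemma linext_sum: "linext g (\<Sum>i\<in>I. f i) = (\<Sum>i\<in>I. linext g (f i))"
  by (induction I rule: infinite_finite_induct) (auto simp: linext_add)

lemma linext_diff: "linext g (p - q) = linext g p - linext g q"
  using linext_add[of g "p - q" q] by simp

lemma linext_fun_sum: "linext (\<lambda>m. \<Sum>j\<in>J. g j m) p = (\<Sum>j\<in>J. linext (g j) p)"
  unfolding linext_def sum_distrib_left by (rule sum.swap)

lemma linext_single_mult:
  "linext g (single m c * p) = c * linext (\<lambda>k. g (m + k)) p"
proof -
  have "single m c * p = (\<Sum>k\<in>keys p. single (m + k) (c * lookup p k))"
    by (subst sum_of_monomials[of p, symmetric]) (simp add: sum_distrib_left mult_single)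
  then show ?thesis
    by (simp add: linext_sum linext_def[of _ p] sum_distrib_left mult.assoc)
qed

lemma linext_mult:
  assumes "\<And>m k. g (m + k) = g m * g k"
  shows "linext g (p * q) = linext g p * linext g q"
proof -
  have "linext (\<lambda>k. g (m + k)) q = g m * linext g q" for m
    by (simp add: assms linext_def sum_distrib_left ac_simps)
  then have "linext g (single m c * q) = linext g (single m c) * linext g q" for m c
    by (simp add: linext_single_mult ac_simps)
  moreover have "p * q = (\<Sum>m\<in>keys p. single m (lookup p m) * q)"
    by (simp add: sum_of_monomials flip: sum_distrib_right)
  ultimately have "linext g (p * q) = (\<Sum>m\<in>keys p. linext g (single m (lookup p m))) * linext g q"
    by (simp add: linext_sum sum_distrib_right)
  then show ?thesis
    by (simp only: linext_single linext_def[of g p])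
qed

text \<open>
  An ideal-theoretic condition on \<^term>\<open>p\<close> can be tested on monomial multiples; this converts
  between the coefficients of a derivative, which correspond to monomials, and an ideal.
\<close>
lemma linext_mult_vanish_iff:
  "(\<forall>q. linext g (q * p) = 0) \<longleftrightarrow> (\<forall>m. linext g (single m 1 * p) = 0)"
proof (intro iffI allI)
  fix q assume monomials: "\<forall>m. linext g (single m 1 * p) = 0"
  have "q * p = (\<Sum>m\<in>keys q. single m (lookup q m) * p)"
    by (simp add: sum_of_monomials flip: sum_distrib_right)
  then have "linext g (q * p) = (\<Sum>m\<in>keys q. lookup q m * linext g (single m 1 * p))"
    by (simp add: linext_sum linext_single_mult)
  then show "linext g (q * p) = 0"
    by (simp only: monomials mult_zero_right sum.neutral_const)
qed blast


section \<open>Evaluation of monomials and polynomials\<close>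

definition monval :: "('v \<Rightarrow> 'k::comm_semiring_1) \<Rightarrow> ('v \<Rightarrow>\<^sub>0 nat) \<Rightarrow> 'k" where
  "monval a m = (\<Prod>v\<in>keys m. a v ^ lookup m v)"

lemma mpoly_eval_eq_linext: "mpoly_eval a = linext (monval a)"
  by (simp add: fun_eq_iff mpoly_eval_def linext_def monval_def)

lemma monval_superset:
  assumes "finite V" "keys m \<subseteq> V"
  shows "monval a m = (\<Prod>v\<in>V. a v ^ lookup m v)"
  unfolding monval_def using assms
  by (intro prod.mono_neutral_left) (auto simp: in_keys_iff)

lemma monval_zero [simp]: "monval a 0 = 1"
  by (simp add: monval_def)

lemma monval_single [simp]: "monval a (single v k) = a v ^ k"
  by (cases "k = 0") (auto simp: monval_def)

lemma monval_add: "monval a (m + m') = monval a m * monval a m'"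
proof -
  let ?V = "keys m \<union> keys m'"
  have "keys (m + m') \<subseteq> ?V" by (rule Poly_Mapping.keys_add)
  then show ?thesis
    by (simp add: monval_superset[where V = ?V] lookup_add power_add prod.distrib)
qed

lemma monval_cong: "(\<And>v. v \<in> keys m \<Longrightarrow> a v = b v) \<Longrightarrow> monval a m = monval b m"
  by (simp add: monval_def)

lemma monval_eq_0: "v \<in> keys m \<Longrightarrow> a v = 0 \<Longrightarrow> monval a m = 0"
  unfolding monval_def by (intro prod_zero bexI[of _ v]) (auto simp: in_keys_iff zero_power)

lemma monval_fun_power: "monval (\<lambda>v. a v ^ j) m = monval a m ^ j"
  by (simp add: monval_def prod_power_distrib power_mult[symmetric] mult.commute)

lemma monval_of_nat: "monval (\<lambda>v. of_nat (a v)) m = of_nat (monval a m)"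
  by (simp add: monval_def)

lemma mpoly_eval_one [simp]: "mpoly_eval a 1 = 1"
  by (simp add: mpoly_eval_eq_linext flip: single_one)

lemma mpoly_eval_const [simp]: "mpoly_eval a (mconst c) = c"
  by (simp add: mpoly_eval_eq_linext mconst_def)

lemma mpoly_eval_var [simp]: "mpoly_eval a (mvar v) = a v"
  by (simp add: mpoly_eval_eq_linext mvar_def)

lemma mpoly_eval_single [simp]: "mpoly_eval a (single m c) = c * monval a m"
  by (simp add: mpoly_eval_eq_linext)

lemma mpoly_eval_add: "mpoly_eval a (p + q) = mpoly_eval a p + mpoly_eval a q"
  by (simp add: mpoly_eval_eq_linext linext_add)

lemma mpoly_eval_diff: "mpoly_eval a (p - q) = mpoly_eval a p - mpoly_eval a q"
  by (simp add: mpoly_eval_eq_linext linext_diff)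

lemma mpoly_eval_sum: "mpoly_eval a (\<Sum>i\<in>I. f i) = (\<Sum>i\<in>I. mpoly_eval a (f i))"
  by (simp add: mpoly_eval_eq_linext linext_sum)

lemma mpoly_eval_mult: "mpoly_eval a (p * q) = mpoly_eval a p * mpoly_eval a q"
  by (simp add: mpoly_eval_eq_linext linext_mult monval_add)

lemma mpoly_eval_power: "mpoly_eval a (p ^ k) = mpoly_eval a p ^ k"
  by (induction k) (auto simp: mpoly_eval_mult)


section \<open>Polynomial rings and their graded pieces\<close>

lemma mpolys_zero [simp]: "0 \<in> mpolys V"
  by (simp add: mpolys_def)

lemma mpolys_one [simp]: "1 \<in> mpolys V"
  by (simp add: mpolys_def)

lemma mpolys_const [simp]: "mconst c \<in> mpolys V"
  by (simp add: mpolys_def mconst_def)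

lemma mpolys_var [simp]: "v \<in> V \<Longrightarrow> mvar v \<in> mpolys V"
  by (simp add: mpolys_def mvar_def)

lemma mpolys_add: "p \<in> mpolys V \<Longrightarrow> q \<in> mpolys V \<Longrightarrow> p + q \<in> mpolys V"
  using Poly_Mapping.keys_add[of p q] by (fastforce simp: mpolys_def)

lemma mpolys_uminus: "p \<in> mpolys V \<Longrightarrow> - p \<in> mpolys V" for p :: "('v, 'k::comm_ring_1) mpoly"
  by (simp add: mpolys_def in_keys_iff)

lemma mpolys_mult: "p \<in> mpolys V \<Longrightarrow> q \<in> mpolys V \<Longrightarrow> p * q \<in> mpolys V"
  for p :: "('v, 'k::comm_ring_1) mpoly"
proof -
  assume p: "p \<in> mpolys V" and q: "q \<in> mpolys V"
  have "keys m \<subseteq> V" if "m \<in> keys (p * q)" for m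
  proof -
    from that obtain a b where "a \<in> keys p" "b \<in> keys q" "m = a + b"
      using Poly_Mapping.keys_mult[of p q] by auto
    moreover from this p q have "keys a \<subseteq> V" "keys b \<subseteq> V"
      by (auto simp: mpolys_def)
    ultimately show ?thesis
      using Poly_Mapping.keys_add[of a b] by blast
  qed
  then show ?thesis by (auto simp: mpolys_def)
qed

lemma mdeg_superset:
  assumes "finite V" "keys m \<subseteq> V"
  shows "mdeg m = (\<Sum>v\<in>V. lookup m v)"
  unfolding mdeg_def using assms
  by (intro sum.mono_neutral_left) (auto simp: in_keys_iff)

lemma mdeg_add: "mdeg (m + m') = mdeg m + mdeg m'"
proof -
  let ?V = "keys m \<union> keys m'"
  have "keys (m + m') \<subseteq> ?V" by (rule Poly_Mapping.keys_add)
  then show ?thesis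
    by (simp add: mdeg_superset[where V = ?V] lookup_add sum.distrib)
qed

lemma mdeg_single [simp]: "mdeg (single v k) = k"
  by (cases "k = 0") (auto simp: mdeg_def)

lemma mdeg_eq_0_iff: "mdeg m = 0 \<longleftrightarrow> m = 0"
  by (auto simp: mdeg_def in_keys_iff sum_eq_0_iff intro!: poly_mapping_eqI)

lemma homogeneous_part_subset: "homogeneous_part V i \<subseteq> mpolys V"
  by (auto simp: homogeneous_part_def)

lemma homogeneous_zero [simp]: "0 \<in> homogeneous_part V i"
  by (simp add: homogeneous_part_def)

lemma homogeneous_add:
  "p \<in> homogeneous_part V i \<Longrightarrow> q \<in> homogeneous_part V i \<Longrightarrow> p + q \<in> homogeneous_part V i"
  using Poly_Mapping.keys_add[of p q] by (auto simp: homogeneous_part_def mpolys_add)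

lemma homogeneous_sum:
  "(\<And>j. j \<in> J \<Longrightarrow> f j \<in> homogeneous_part V i) \<Longrightarrow> (\<Sum>j\<in>J. f j) \<in> homogeneous_part V i"
  by (induction J rule: infinite_finite_induct) (auto simp: homogeneous_add)

lemma homogeneous_diff:
  fixes p q :: "('v, 'k::comm_ring_1) mpoly"
  assumes "p \<in> homogeneous_part V i" "q \<in> homogeneous_part V i"
  shows "p - q \<in> homogeneous_part V i"
proof -
  have "- q \<in> homogeneous_part V i"
    using assms(2) by (auto simp: homogeneous_part_def mpolys_uminus in_keys_iff)
  from homogeneous_add[OF assms(1) this] show ?thesis by simp
qed

lemma homogeneous_mult:
  fixes p q :: "('v, 'k::comm_ring_1) mpoly"
  assumes "p \<in> homogeneous_part V i" "q \<in> homogeneous_part V j"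
  shows "p * q \<in> homogeneous_part V (i + j)"
proof -
  have "mdeg m = i + j" if "m \<in> keys (p * q)" for m
  proof -
    from that obtain a b where "a \<in> keys p" "b \<in> keys q" "m = a + b"
      using Poly_Mapping.keys_mult[of p q] by auto
    with assms show ?thesis
      by (auto simp: homogeneous_part_def mdeg_add)
  qed
  with assms show ?thesis by (auto simp: homogeneous_part_def mpolys_mult)
qed

lemma homogeneous_single:
  "keys m \<subseteq> V \<Longrightarrow> mdeg m = i \<Longrightarrow> single m c \<in> homogeneous_part V i"
  by (auto simp: homogeneous_part_def mpolys_def)

lemma homogeneous_var_power:
  "v \<in> V \<Longrightarrow> (mvar v :: ('v, 'k::comm_ring_1) mpoly) ^ k \<in> homogeneous_part V k"
proof (induction k)
  case 0
  then show ?case by (auto simp: homogeneous_part_def mdeg_def)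
next
  case (Suc k)
  have "(mvar v :: ('v, 'k) mpoly) \<in> homogeneous_part V 1"
    unfolding mvar_def using Suc.prems by (intro homogeneous_single) auto
  from homogeneous_mult[OF this Suc.IH[OF Suc.prems]] show ?case by simp
qed

lemma cring_mpoly_ring: "cring (mpoly_ring V :: ('v, 'k::comm_ring_1) mpoly ring)"
proof (rule cringI)
  show "abelian_group (mpoly_ring V :: ('v, 'k) mpoly ring)"
  proof (rule abelian_groupI)
    show "\<exists>y\<in>carrier (mpoly_ring V). y \<oplus>\<^bsub>mpoly_ring V\<^esub> x = \<zero>\<^bsub>mpoly_ring V\<^esub>"
      if "x \<in> carrier (mpoly_ring V)" for x :: "('v, 'k) mpoly"
      using that by (intro bexI[of _ "- x"]) (auto simp: mpoly_ring_def mpolys_uminus)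
  qed (auto simp: mpoly_ring_def mpolys_add ac_simps)
  show "comm_monoid (mpoly_ring V :: ('v, 'k) mpoly ring)"
    by (rule comm_monoidI) (auto simp: mpoly_ring_def mpolys_mult ac_simps)
qed (auto simp: mpoly_ring_def algebra_simps)

lemma mpoly_ring_minus:
  fixes p q :: "('v, 'k::comm_ring_1) mpoly"
  assumes "p \<in> mpolys V" "q \<in> mpolys V"
  shows "p \<ominus>\<^bsub>mpoly_ring V\<^esub> q = p - q"
proof -
  interpret cring "mpoly_ring V :: ('v, 'k) mpoly ring" by (rule cring_mpoly_ring)
  have "\<ominus>\<^bsub>mpoly_ring V\<^esub> q = - q"
    using assms by (intro minus_equality) (auto simp: mpoly_ring_def mpolys_uminus)
  then show ?thesis by (simp add: a_minus_def mpoly_ring_def)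
qed

lemma mpoly_ring_pow: "p [^]\<^bsub>mpoly_ring V\<^esub> (k::nat) = p ^ k"
  by (induction k) (auto simp: mpoly_ring_def nat_pow_def mult.commute)


section \<open>The annihilator as the kernel of a pairing\<close>

definition mfact :: "('v \<Rightarrow>\<^sub>0 nat) \<Rightarrow> 'k::comm_ring_1" where
  "mfact u = (\<Prod>v\<in>keys u. of_nat (fact (lookup u v)))"

text \<open>
  These are the coefficients of \<^term>\<open>F\<close> with respect to the divided powers
  $X^u / u!$. In this basis differentiation by a monomial only shifts indices, without numerical
  factors.
\<close>
definition dpcoeff :: "('v, 'k::comm_ring_1) mpoly \<Rightarrow> ('v \<Rightarrow>\<^sub>0 nat) \<Rightarrow> 'k" where
  "dpcoeff F u = mfact u * lookup F u"

lemma mfact_zero [simp]: "mfact 0 = 1"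
  by (simp add: mfact_def)

lemma mfact_nonzero: "mfact u \<noteq> (0 :: 'k::{idom, ring_char_0})"
  by (simp add: mfact_def)

lemma mfact_superset:
  assumes "finite V" "keys u \<subseteq> V"
  shows "mfact u = (\<Prod>v\<in>V. of_nat (fact (lookup u v)))"
  unfolding mfact_def using assms
  by (intro prod.mono_neutral_left) (auto simp: in_keys_iff)

lemma mfact_add_single:
  "mfact (u + single v 1) = of_nat (Suc (lookup u v)) * (mfact u :: 'k::comm_ring_1)"
proof -
  let ?V = "insert v (keys u)"
  have "keys (u + single v 1) \<subseteq> ?V"
    using Poly_Mapping.keys_add[of u "single v 1"] by auto
  then have "mfact (u + single v 1) = (\<Prod>w\<in>?V. of_nat (fact (lookup (u + single v 1) w)) :: 'k)"
    by (intro mfact_superset) auto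
  also have "\<dots> = of_nat (fact (Suc (lookup u v))) * (\<Prod>w\<in>keys u - {v}. of_nat (fact (lookup u w)))"
    by (subst prod.insert_remove)
      (auto simp: lookup_add lookup_single when_def intro!: arg_cong2[where f = "(*)"] prod.cong split: if_splits)
  also have "\<dots> = of_nat (Suc (lookup u v)) * (\<Prod>w\<in>?V. of_nat (fact (lookup u w)))"
    by (subst prod.insert_remove) (auto simp: algebra_simps)
  also have "(\<Prod>w\<in>?V. of_nat (fact (lookup u w))) = (mfact u :: 'k)"
    by (rule mfact_superset[symmetric]) auto
  finally show ?thesis .
qed

lemma minus_single_add:
  "v \<in> keys u \<Longrightarrow> (u - single v 1) + single v (1::nat) = u"
  by (rule poly_mapping_eqI)
    (auto simp: lookup_add lookup_minus lookup_single when_def in_keys_iff)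

lemma lookup_mpderiv:
  "lookup (mpderiv v F) u = of_nat (Suc (lookup u v)) * lookup F (u + single v 1)"
proof -
  have "lookup (mpderiv v F) u = (\<Sum>m\<in>keys F.
      if m = u + single v 1 then of_nat (Suc (lookup u v)) * lookup F m else 0)"
    unfolding mpderiv_def lookup_sum
  proof (rule sum.cong)
    fix m
    show "lookup (single (m - single v 1) (of_nat (lookup m v) * lookup F m)) u =
        (if m = u + single v 1 then of_nat (Suc (lookup u v)) * lookup F m else 0)"
    proof (cases "m = u + single v 1")
      case True
      then have "m - single v 1 = u" "lookup m v = Suc (lookup u v)"
        by (auto simp: lookup_add)
      with True show ?thesis by simp
    next
      case False
      then have "lookup m v = 0 \<or> m - single v 1 \<noteq> u"
        using minus_single_add[of v m] by (auto simp: in_keys_iff)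
      with False show ?thesis by (auto simp: lookup_single_not_eq)
    qed
  qed simp
  then show ?thesis by (simp add: in_keys_iff)
qed

lemma dpcoeff_mpderiv: "dpcoeff (mpderiv v F) u = dpcoeff F (u + single v 1)"
  unfolding dpcoeff_def lookup_mpderiv mfact_add_single by (simp add: ac_simps)

lemma dpcoeff_mpderiv_power: "dpcoeff ((mpderiv v ^^ k) F) u = dpcoeff F (u + single v k)"
proof (induction k arbitrary: u)
  case (Suc k)
  have "single v 1 + single v k = single v (Suc k)"
    by (simp flip: single_add)
  then show ?case
    by (simp add: dpcoeff_mpderiv Suc.IH add.assoc)
qed simp

lemma dpcoeff_foldr_mpderiv:
  "distinct vs \<Longrightarrow> dpcoeff (foldr (\<lambda>v. mpderiv v ^^ lookup m v) vs F) u =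
     dpcoeff F (u + (\<Sum>v\<in>set vs. single v (lookup m v)))"
  by (induction vs arbitrary: u) (auto simp: dpcoeff_mpderiv_power add.assoc)

lemma dpcoeff_monom_diff: "dpcoeff (monom_diff m F) u = dpcoeff F (u + m)"
  by (simp add: monom_diff_def dpcoeff_foldr_mpderiv sum_of_monomials)

lemma lookup_const_mult: "lookup (mconst c * p) u = c * lookup p u"
proof -
  have "mconst c * p = (\<Sum>m\<in>keys p. single m (c * lookup p m))"
    by (subst sum_of_monomials[of p, symmetric])
      (simp add: mconst_def sum_distrib_left mult_single)
  then show ?thesis
    by (auto simp: lookup_sum lookup_single when_def in_keys_iff)
qed

text \<open>
  All divided power coefficients of the derivative of \<^term>\<open>F\<close> by \<^term>\<open>p\<close> are values of a
  single linear functional, the constant term of differentiation, at the monomial multiples of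
  \<^term>\<open>p\<close>.
\<close>
lemma dpcoeff_mpoly_diff: "dpcoeff (mpoly_diff p F) u = linext (dpcoeff F) (single u 1 * p)"
proof -
  have "dpcoeff (mpoly_diff p F) u = (\<Sum>m\<in>keys p. lookup p m * dpcoeff (monom_diff m F) u)"
    by (simp add: dpcoeff_def mpoly_diff_def lookup_sum lookup_const_mult sum_distrib_left
        mult.left_commute)
  then show ?thesis
    by (simp add: dpcoeff_monom_diff linext_single_mult linext_def[of _ p])
qed

text \<open>
  In characteristic zero the factorials are nonzero, so the annihilator is the largest ideal in
  the kernel of the functional \<^term>\<open>linext (dpcoeff F)\<close>. This description makes the ideal
  property evident, whereas the definition by iterated derivatives does not.
\<close>
lemma Ann_iff:
  fixes F :: "(nat, 'k::{idom, ring_char_0}) mpoly"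
  shows "p \<in> Ann n F \<longleftrightarrow> p \<in> mpolys {..<n} \<and> (\<forall>q. linext (dpcoeff F) (q * p) = 0)"
proof -
  have "mpoly_diff p F = 0 \<longleftrightarrow> (\<forall>u. dpcoeff (mpoly_diff p F) u = 0)"
    by (auto simp: dpcoeff_def mfact_nonzero poly_mapping_eq_iff fun_eq_iff)
  also have "\<dots> \<longleftrightarrow> (\<forall>u. linext (dpcoeff F) (single u 1 * p) = 0)"
    by (simp add: dpcoeff_mpoly_diff)
  also have "\<dots> \<longleftrightarrow> (\<forall>q. linext (dpcoeff F) (q * p) = 0)"
    by (rule linext_mult_vanish_iff[symmetric])
  finally show ?thesis by (auto simp: Ann_def)
qed

lemma Ann_mult:
  fixes F :: "(nat, 'k::{idom, ring_char_0}) mpoly"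
  assumes "p \<in> Ann n F" "q \<in> mpolys {..<n}"
  shows "q * p \<in> Ann n F"
  using assms by (auto simp: Ann_iff mpolys_mult simp flip: mult.assoc)

lemma ideal_Ann:
  fixes F :: "(nat, 'k::{idom, ring_char_0}) mpoly"
  shows "ideal (Ann n F) (mpoly_ring {..<n})"
proof -
  interpret R: cring "mpoly_ring {..<n} :: (nat, 'k) mpoly ring" by (rule cring_mpoly_ring)
  have minus: "\<ominus>\<^bsub>mpoly_ring {..<n}\<^esub> p = - p" if "p \<in> mpolys {..<n}" for p :: "(nat, 'k) mpoly"
    using that by (intro R.minus_equality) (auto simp: mpoly_ring_def mpolys_uminus)
  show ?thesis
  proof (rule idealI)
    show "subgroup (Ann n F) (add_monoid (mpoly_ring {..<n}))"
    proof (rule subgroup.intro)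
      fix p assume p: "p \<in> Ann n F"
      have "- p \<in> Ann n F"
        using Ann_mult[OF p, of "- 1"] by (simp add: mpolys_uminus)
      then show "inv\<^bsub>add_monoid (mpoly_ring {..<n})\<^esub> p \<in> Ann n F"
        using p minus[of p] by (simp add: Ann_iff a_inv_def)
    qed (auto simp: Ann_iff mpoly_ring_def mpolys_add distrib_left linext_add)
    fix p q :: "(nat, 'k) mpoly" assume "p \<in> Ann n F" "q \<in> carrier (mpoly_ring {..<n})"
    then show "q \<otimes>\<^bsub>mpoly_ring {..<n}\<^esub> p \<in> Ann n F" "p \<otimes>\<^bsub>mpoly_ring {..<n}\<^esub> q \<in> Ann n F"
      using Ann_mult[of p n F q] by (auto simp: mpoly_ring_def mult.commute)
  qed (rule R.ring_axioms)
qed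


section \<open>The pairing for a sum of powers of linear forms\<close>

lemma dpcoeff_sum: "dpcoeff (\<Sum>i\<in>I. f i) u = (\<Sum>i\<in>I. dpcoeff (f i) u)"
  by (simp add: dpcoeff_def lookup_sum sum_distrib_left)

lemma dpcoeff_const_mult: "dpcoeff (mconst c * G) u = c * dpcoeff G u"
  by (simp add: dpcoeff_def lookup_const_mult mult.left_commute)

lemma dpcoeff_var_mult:
  fixes G :: "('v, 'k::comm_ring_1) mpoly"
  shows "dpcoeff (mvar v * G) u = of_nat (lookup u v) * dpcoeff G (u - single v 1)"
proof -
  have "mvar v * G = (\<Sum>k\<in>keys G. single (k + single v 1) (lookup G k))"
    by (subst sum_of_monomials[of G, symmetric])
      (simp add: mvar_def sum_distrib_left mult_single ac_simps)
  then have *: "lookup (mvar v * G) u =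
      (\<Sum>k\<in>keys G. if k + single v 1 = u then lookup G k else 0)"
    by (simp add: lookup_sum lookup_single when_def)
  show ?thesis
  proof (cases "v \<in> keys u")
    case True
    note u = minus_single_add[OF True]
    have "k + single v 1 = u \<longleftrightarrow> k = u - single v 1" for k
      using u by (metis add_diff_cancel_right')
    with * have "lookup (mvar v * G) u = lookup G (u - single v 1)"
      by (simp add: in_keys_iff)
    moreover have "mfact u = of_nat (lookup u v) * (mfact (u - single v 1) :: 'k)"
      using mfact_add_single[of "u - single v 1" v, unfolded u] True
      by (simp add: lookup_minus in_keys_iff)
    ultimately show ?thesis by (simp add: dpcoeff_def ac_simps)
  next
    case False
    then have "k + single v 1 \<noteq> u" for k
      by (auto simp: in_keys_iff lookup_add)
    with * False show ?thesis by (simp add: dpcoeff_def in_keys_iff)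
  qed
qed

text \<open>
  The coefficient vector of a linear form, viewed as a point. It is extended by zero outside the
  variables in use, so that monomials involving foreign variables evaluate to zero; the
  formula for the coefficients of a power then holds for monomials in any variables.
\<close>
definition coeff_point :: "nat \<Rightarrow> (nat \<Rightarrow> 'k::zero) \<Rightarrow> nat \<Rightarrow> 'k" where
  "coeff_point n c v = (if v < n then c v else 0)"

text \<open>
  The multinomial theorem: the coefficient of $X^u$ in $\ell^d$ is $(d!/u!)\, c^u$. By induction on
  the degree, using that multiplication by $X_v$ multiplies divided power coefficients by $u_v$,
  and that the exponents $u_v$ sum to the degree of $u$.
\<close>
lemma dpcoeff_linear_form_power:
  fixes c :: "nat \<Rightarrow> 'k::comm_ring_1"
  shows "dpcoeff (linear_form n c ^ d) u =
     (if mdeg u = d then of_nat (fact d) * monval (coeff_point n c) u else 0)"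
proof (induction d arbitrary: u)
  case 0
  show ?case
    by (auto simp: dpcoeff_def lookup_one mdeg_eq_0_iff when_def)
next
  case (Suc d)
  let ?L = "linear_form n c" and ?c = "coeff_point n c"
  have "dpcoeff (?L ^ Suc d) u =
      (\<Sum>v<n. c v * (of_nat (lookup u v) * dpcoeff (?L ^ d) (u - single v 1)))"
    by (simp add: linear_form_def[of n c] sum_distrib_right dpcoeff_sum mult.assoc
        dpcoeff_const_mult dpcoeff_var_mult)
  also have "\<dots> = (\<Sum>v<n. of_nat (lookup u v) *
      (if mdeg u = Suc d then of_nat (fact d) * monval ?c u else 0))"
  proof (rule sum.cong)
    fix v assume v: "v \<in> {..<n}"
    show "c v * (of_nat (lookup u v) * dpcoeff (?L ^ d) (u - single v 1)) =
        of_nat (lookup u v) * (if mdeg u = Suc d then of_nat (fact d) * monval ?c u else 0)"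
    proof (cases "v \<in> keys u")
      case True
      note u = minus_single_add[OF True]
      have "mdeg u = Suc (mdeg (u - single v 1))"
        using mdeg_add[of "u - single v 1" "single v 1", unfolded u] by simp
      moreover have "monval ?c u = monval ?c (u - single v 1) * c v"
        using monval_add[of ?c "u - single v 1" "single v 1", unfolded u] v
        by (simp add: coeff_point_def)
      ultimately show ?thesis by (simp add: Suc.IH ac_simps)
    qed (simp add: in_keys_iff)
  qed simp
  also have "\<dots> = (if mdeg u = Suc d then of_nat (fact (Suc d)) * monval ?c u else 0)"
  proof (cases "keys u \<subseteq> {..<n}")
    case True
    then have "mdeg u = (\<Sum>v<n. lookup u v)"
      by (simp add: mdeg_superset[of "{..<n}"])
    then have *: "(\<Sum>v<n. of_nat (lookup u v) * x) = of_nat (mdeg u) * x" for x :: 'k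
      by (simp add: sum_distrib_right)
    show ?thesis unfolding * by (simp add: algebra_simps)
  next
    case False
    then obtain v where "v \<in> keys u" "\<not> v < n" by auto
    then have "monval ?c u = 0" by (intro monval_eq_0[of v]) (auto simp: coeff_point_def)
    then show ?thesis by simp
  qed
  finally show ?case .
qed

abbreviation form_point :: "nat \<Rightarrow> (nat \<times> nat \<Rightarrow> 'k::zero) \<Rightarrow> nat \<Rightarrow> nat \<Rightarrow> 'k" where
  "form_point n a j \<equiv> coeff_point n (\<lambda>v. a (j, v))"

lemma dpcoeff_power_sum_form:
  "dpcoeff (power_sum_form n d s a) u =
     (if mdeg u = d then of_nat (fact d) * (\<Sum>j<s. monval (form_point n a j) u) else 0)"
  by (simp add: power_sum_form_def dpcoeff_sum dpcoeff_linear_form_power sum_distrib_left)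

lemma linext_power_sum_form:
  assumes "p \<in> homogeneous_part V e"
  shows "linext (dpcoeff (power_sum_form n d s a)) p =
    (if e = d then of_nat (fact d) * (\<Sum>j<s. mpoly_eval (form_point n a j) p) else 0)"
proof -
  have "linext (dpcoeff (power_sum_form n d s a)) p =
      (\<Sum>m\<in>keys p. lookup p m *
        (if e = d then of_nat (fact d) * (\<Sum>j<s. monval (form_point n a j) m) else 0))"
    unfolding linext_def using assms
    by (intro sum.cong) (auto simp: dpcoeff_power_sum_form homogeneous_part_def)
  also have "\<dots> = (if e = d then of_nat (fact d) *
      linext (\<lambda>m. \<Sum>j<s. monval (form_point n a j) m) p else 0)"
    by (simp add: linext_def sum_distrib_left ac_simps)
  finally show ?thesis
    by (simp add: linext_fun_sum mpoly_eval_eq_linext)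
qed

lemma Ann_above_degree:
  fixes a :: "nat \<times> nat \<Rightarrow> 'k::{idom, ring_char_0}"
  assumes p: "p \<in> homogeneous_part {..<n} i" and "d < i"
  shows "p \<in> Ann n (power_sum_form n d s a)"
proof -
  have p': "p \<in> homogeneous_part UNIV i"
    using p by (auto simp: homogeneous_part_def mpolys_def)
  have "linext (dpcoeff (power_sum_form n d s a)) (single m 1 * p) = 0" for m
    using linext_power_sum_form[OF homogeneous_mult[OF homogeneous_single[OF subset_UNIV refl] p']]
      \<open>d < i\<close> by simp
  then show ?thesis
    using p homogeneous_part_subset by (auto simp: Ann_iff linext_mult_vanish_iff)
qed

text \<open>
  This is Gorenstein duality for a sum of powers: on forms of degree $d$ the functional is, up to
  the nonzero factor $d!$, the sum of the values at the points. Membership in the annihilator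
  thus depends only on the values at the points, tested against forms of complementary degree.
\<close>
lemma homogeneous_Ann_iff:
  fixes a :: "nat \<times> nat \<Rightarrow> 'k::{idom, ring_char_0}"
  assumes p: "p \<in> homogeneous_part {..<n} i" and d: "e + i = d"
  shows "p \<in> Ann n (power_sum_form n d s a) \<longleftrightarrow>
    (\<forall>q\<in>homogeneous_part {..<n} e.
      (\<Sum>j<s. mpoly_eval (form_point n a j) q * mpoly_eval (form_point n a j) p) = 0)"
    (is "_ \<longleftrightarrow> ?orth")
proof
  assume Ann: "p \<in> Ann n (power_sum_form n d s a)"
  show ?orth
  proof
    fix q :: "(nat, 'k) mpoly" assume q: "q \<in> homogeneous_part {..<n} e"
    have "linext (dpcoeff (power_sum_form n d s a)) (q * p) = 0"
      using Ann by (simp add: Ann_iff)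
    then show "(\<Sum>j<s. mpoly_eval (form_point n a j) q * mpoly_eval (form_point n a j) p) = 0"
      using d by (simp add: linext_power_sum_form[OF homogeneous_mult[OF q p]] mpoly_eval_mult)
  qed
next
  assume orth: ?orth
  have p': "p \<in> homogeneous_part UNIV i"
    using p by (auto simp: homogeneous_part_def mpolys_def)
  have "linext (dpcoeff (power_sum_form n d s a)) (single m 1 * p) = 0" for m
  proof -
    have "linext (dpcoeff (power_sum_form n d s a)) (single m 1 * p) =
       (if mdeg m + i = d then of_nat (fact d) * (\<Sum>j<s. mpoly_eval (form_point n a j)
         (single m 1 * p)) else 0)"
      by (rule linext_power_sum_form[OF
          homogeneous_mult[OF homogeneous_single[OF subset_UNIV refl] p']])
    moreover have "(\<Sum>j<s. mpoly_eval (form_point n a j) (single m 1 * p)) = 0" if "mdeg m = e"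
    proof (cases "keys m \<subseteq> {..<n}")
      case True
      then show ?thesis
        using orth homogeneous_single[OF True that] unfolding mpoly_eval_mult by blast
    next
      case False
      then obtain v where "v \<in> keys m" "\<not> v < n" by auto
      then have "monval (form_point n a j) m = 0" for j
        by (intro monval_eq_0[of v]) (auto simp: coeff_point_def)
      then show ?thesis by (simp add: mpoly_eval_mult)
    qed
    ultimately show ?thesis using d by auto
  qed
  then show "p \<in> Ann n (power_sum_form n d s a)"
    using p homogeneous_part_subset by (auto simp: Ann_iff linext_mult_vanish_iff)
qed


section \<open>Reduction to solvable normal equations\<close>

text \<open>
  The maps $\times \ell^{d-2i} : [A]_i \to [A]_{d-i}$ control all others. If $2i + k \le d$ then
  $\times \ell^k$ is the first factor of such a map, hence injective; otherwise it is the last factor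
  of the map starting in degree $d - (i + k)$, or its target vanishes, so it is surjective.
\<close>
lemma strong_lefschetz_if_middle_bijective:
  fixes F :: "(nat, 'k::{idom, ring_char_0}) mpoly"
  assumes l: "l \<in> homogeneous_part {..<n} 1"
    and top: "\<And>i p. d < i \<Longrightarrow> p \<in> homogeneous_part {..<n} i \<Longrightarrow> p \<in> Ann n F"
    and inj: "\<And>i p. 2 * i \<le> d \<Longrightarrow> p \<in> homogeneous_part {..<n} i \<Longrightarrow>
      l ^ (d - 2 * i) * p \<in> Ann n F \<Longrightarrow> p \<in> Ann n F"
    and surj: "\<And>i r. 2 * i \<le> d \<Longrightarrow> r \<in> homogeneous_part {..<n} (d - i) \<Longrightarrow>
      \<exists>p \<in> homogeneous_part {..<n} i. l ^ (d - 2 * i) * p - r \<in> Ann n F"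
  shows "strong_lefschetz (macaulay_algebra n F) (macaulay_part n F)"
proof -
  let ?R = "mpoly_ring {..<n} :: (nat, 'k) mpoly ring"
  let ?A = "macaulay_algebra n F"
  let ?H = "homogeneous_part {..<n} :: nat \<Rightarrow> (nat, 'k) mpoly set"
  define cls where "cls = a_r_coset ?R (Ann n F)"
  have A: "?A = ?R Quot Ann n F" by (simp add: macaulay_algebra_def)
  have part: "macaulay_part n F i = cls ` ?H i" for i
    by (simp add: macaulay_part_def cls_def)
  have H: "p \<in> carrier ?R" if "p \<in> ?H i" for p i
    using that homogeneous_part_subset by (auto simp: mpoly_ring_def)
  interpret R: cring ?R by (rule cring_mpoly_ring)
  interpret hom: ring_hom_ring ?R ?A cls
    unfolding A cls_def by (rule ideal.rcos_ring_hom_ring[OF ideal_Ann])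
  have cls_eq: "cls p = cls q \<longleftrightarrow> p - q \<in> Ann n F" if "p \<in> ?H i" "q \<in> ?H i" for p q i
    using R.quotient_eq_iff_same_a_r_cos[OF ideal_Ann H[OF that(1)] H[OF that(2)]]
      mpoly_ring_minus[of p "{..<n}" q] H[OF that(1)] H[OF that(2)]
    by (simp add: cls_def mpoly_ring_def)
  have l_pow: "l ^ k \<in> ?H k" for k
  proof (induction k)
    case 0
    then show ?case by (auto simp: homogeneous_part_def mdeg_def)
  next
    case (Suc k)
    from homogeneous_mult[OF l this] show ?case by simp
  qed
  have l_pow_mult: "l ^ k * p \<in> ?H (i + k)" if "p \<in> ?H i" for p i k
    using homogeneous_mult[OF l_pow[of k] that] by (simp add: add.commute)
  have mult: "(cls l [^]\<^bsub>?A\<^esub> k) \<otimes>\<^bsub>?A\<^esub> cls p = cls (l ^ k * p)" if p: "p \<in> ?H i" for p i and k :: nat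
  proof -
    have "cls (l ^ k * p) = cls ((l [^]\<^bsub>?R\<^esub> k) \<otimes>\<^bsub>?R\<^esub> p)"
      unfolding mpoly_ring_pow by (simp add: mpoly_ring_def)
    then show ?thesis
      using H[OF l] H[OF p] by (simp add: hom.hom_nat_pow)
  qed
  have "cls l \<in> macaulay_part n F 1"
    using l by (auto simp: part)
  moreover have "inj_on (\<lambda>x. (cls l [^]\<^bsub>?A\<^esub> k) \<otimes>\<^bsub>?A\<^esub> x) (macaulay_part n F i) \<or>
      (\<lambda>x. (cls l [^]\<^bsub>?A\<^esub> k) \<otimes>\<^bsub>?A\<^esub> x) ` macaulay_part n F i = macaulay_part n F (i + k)" for i k
  proof (cases "2 * i + k \<le> d")
    case True
    have "cls p = cls q" if p: "p \<in> ?H i" and q: "q \<in> ?H i"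
      and eq: "cls (l ^ k * p) = cls (l ^ k * q)" for p q
    proof -
      have "l ^ k * (p - q) \<in> Ann n F"
        using eq cls_eq[OF l_pow_mult[OF p] l_pow_mult[OF q]] by (simp add: right_diff_distrib)
      then have "l ^ (d - 2 * i - k) * (l ^ k * (p - q)) \<in> Ann n F"
        using l_pow homogeneous_part_subset by (blast intro: Ann_mult)
      moreover have "l ^ (d - 2 * i - k) * l ^ k = l ^ (d - 2 * i)"
        using True by (simp flip: power_add)
      ultimately have "l ^ (d - 2 * i) * (p - q) \<in> Ann n F"
        by (simp flip: mult.assoc)
      then have "p - q \<in> Ann n F"
        using True by (intro inj[OF _ homogeneous_diff[OF p q]]) auto
      then show ?thesis using cls_eq[OF p q] by simp
    qed
    then have "inj_on (\<lambda>x. (cls l [^]\<^bsub>?A\<^esub> k) \<otimes>\<^bsub>?A\<^esub> x) (cls ` ?H i)"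
      by (intro inj_onI) (metis (no_types, lifting) imageE mult)
    then show ?thesis unfolding part ..
  next
    case False
    have "\<exists>p\<in>?H i. l ^ k * p - r \<in> Ann n F" if r: "r \<in> ?H (i + k)" for r
    proof (cases "i + k \<le> d")
      case le: True
      let ?j = "d - (i + k)"
      have "2 * ?j \<le> d" "?j \<le> i" "d - ?j = i + k" using False le by auto
      with surj[of ?j r] r obtain p where p: "p \<in> ?H ?j" "l ^ (d - 2 * ?j) * p - r \<in> Ann n F"
        by auto
      have "d - 2 * ?j = k + (i - ?j)" using False le by auto
      then have "l ^ k * (l ^ (i - ?j) * p) - r \<in> Ann n F"
        using p(2) by (simp add: power_add mult.assoc)
      moreover have "l ^ (i - ?j) * p \<in> ?H i"
        using l_pow_mult[OF p(1), of "i - ?j"] \<open>?j \<le> i\<close> by simp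
      ultimately show ?thesis by blast
    next
      case False
      then have "0 - r \<in> Ann n F"
        using r by (intro top[of "i + k"] homogeneous_diff) auto
      then show ?thesis by (intro bexI[of _ 0]) auto
    qed
    then have "cls r \<in> (\<lambda>p. cls (l ^ k * p)) ` ?H i" if "r \<in> ?H (i + k)" for r
      using that cls_eq[OF l_pow_mult that] by (metis imageI)
    moreover have "(\<lambda>x. (cls l [^]\<^bsub>?A\<^esub> k) \<otimes>\<^bsub>?A\<^esub> x) ` macaulay_part n F i = (\<lambda>p. cls (l ^ k * p)) ` ?H i"
      unfolding part image_image by (intro image_cong refl mult)
    ultimately show ?thesis
      using l_pow_mult by (auto simp: part)
  qed
  ultimately show ?thesis
    unfolding strong_lefschetz_def by blast
qed

text \<open>
  Here \<^term>\<open>mvar 0\<close> serves as Lefschetz element, and its value at the \<^term>\<open>j\<close>-th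
  point is \<^term>\<open>a (j, 0)\<close>. Surjectivity in the middle is literally the solvability of the normal
  equations with right-hand side the values of a form. Injectivity follows from the same
  solvability, since the pairing on degree \<^term>\<open>i\<close> is symmetric: an element of the
  kernel is orthogonal to everything in the range.
\<close>
lemma strong_lefschetz_if_normal_equations:
  fixes a :: "nat \<times> nat \<Rightarrow> 'k::{idom, ring_char_0}"
  assumes "0 < n"
    and normal: "\<And>i w. 2 * i \<le> d \<Longrightarrow> \<exists>p\<in>homogeneous_part {..<n} i. \<forall>q\<in>homogeneous_part {..<n} i.
      (\<Sum>j<s. mpoly_eval (form_point n a j) q *
        (a (j, 0) ^ (d - 2 * i) * mpoly_eval (form_point n a j) p - w j)) = 0"
  shows "strong_lefschetz (macaulay_algebra n (power_sum_form n d s a))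
    (macaulay_part n (power_sum_form n d s a))"
proof (rule strong_lefschetz_if_middle_bijective)
  let ?F = "power_sum_form n d s a"
  let ?H = "homogeneous_part {..<n} :: nat \<Rightarrow> (nat, 'k) mpoly set"
  let ?ev = "\<lambda>j. mpoly_eval (form_point n a j)"
  show "mvar 0 \<in> ?H 1"
    using homogeneous_var_power[of 0 "{..<n}" 1] \<open>0 < n\<close> by simp
  show "p \<in> Ann n ?F" if "d < i" "p \<in> ?H i" for i p
    using that by (intro Ann_above_degree)
  have ev_var: "?ev j (mvar 0 ^ e * p) = a (j, 0) ^ e * ?ev j p" for j e p
    using \<open>0 < n\<close> by (simp add: mpoly_eval_mult mpoly_eval_power coeff_point_def)
  have var_mult: "mvar 0 ^ (d - 2 * i) * p \<in> ?H (d - i)" if "2 * i \<le> d" "p \<in> ?H i" for i p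
  proof -
    have "mvar 0 ^ (d - 2 * i) \<in> ?H (d - 2 * i)"
      using \<open>0 < n\<close> by (intro homogeneous_var_power) simp
    from homogeneous_mult[OF this that(2)] that(1) show ?thesis
      by (simp add: mult_2)
  qed
  show "p \<in> Ann n ?F" if i: "2 * i \<le> d" and p: "p \<in> ?H i"
    and Ann: "mvar 0 ^ (d - 2 * i) * p \<in> Ann n ?F" for i p
  proof -
    have "(\<Sum>j<s. ?ev j r * ?ev j p) = 0" if r: "r \<in> ?H (d - i)" for r
    proof -
      obtain p' where p': "p' \<in> ?H i" and eq: "\<forall>q\<in>?H i.
          (\<Sum>j<s. ?ev j q * (a (j, 0) ^ (d - 2 * i) * ?ev j p' - ?ev j r)) = 0"
        using normal[OF i, of "\<lambda>j. ?ev j r"] by blast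
      \<comment> \<open>The weighted pairing of \<^term>\<open>p\<close> and \<^term>\<open>p'\<close> vanishes by the assumption on
        \<^term>\<open>p\<close>, and equals the pairing of \<^term>\<open>p\<close> with \<^term>\<open>r\<close> by the choice of
        \<^term>\<open>p'\<close>.\<close>
      have "(\<Sum>j<s. ?ev j p' * (a (j, 0) ^ (d - 2 * i) * ?ev j p)) = 0"
        using Ann p' i homogeneous_Ann_iff[OF var_mult[OF i p], where e = i and d = d and s = s]
        by (auto simp: ev_var)
      moreover have "(\<Sum>j<s. ?ev j p * (a (j, 0) ^ (d - 2 * i) * ?ev j p' - ?ev j r)) = 0"
        using eq p by blast
      ultimately show ?thesis
        by (simp add: right_diff_distrib sum_subtractf ac_simps)
    qed
    then show ?thesis
      using i homogeneous_Ann_iff[OF p, where e = "d - i" and d = d and s = s] by auto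
  qed
  show "\<exists>p\<in>?H i. mvar 0 ^ (d - 2 * i) * p - r \<in> Ann n ?F"
    if i: "2 * i \<le> d" and r: "r \<in> ?H (d - i)" for i r
  proof -
    obtain p where p: "p \<in> ?H i" and eq: "\<forall>q\<in>?H i.
        (\<Sum>j<s. ?ev j q * (a (j, 0) ^ (d - 2 * i) * ?ev j p - ?ev j r)) = 0"
      using normal[OF i, of "\<lambda>j. ?ev j r"] by blast
    have "mvar 0 ^ (d - 2 * i) * p - r \<in> ?H (d - i)"
      by (rule homogeneous_diff[OF var_mult[OF i p] r])
    then have "mvar 0 ^ (d - 2 * i) * p - r \<in> Ann n ?F"
      using eq i by (subst homogeneous_Ann_iff[where e = i and i = "d - i"])
        (auto simp: mpoly_eval_diff ev_var)
    with p show ?thesis by blast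
  qed
qed


section \<open>Weighted Gram matrices\<close>

text \<open>
  The \<^term>\<open>j\<close>-th of \<^term>\<open>s\<close> points has weight \<^term>\<open>c j\<close>, and
  \<^term>\<open>f j \<alpha>\<close> is the value of the \<^term>\<open>\<alpha>\<close>-th of \<^term>\<open>k\<close> functions there. With
  $V = (f_{j\alpha})$ and $D = \mathrm{diag}(c)$ the matrix is $V^T D V$.
\<close>
definition gram_mat ::
  "nat \<Rightarrow> nat \<Rightarrow> (nat \<Rightarrow> 'k::comm_ring_1) \<Rightarrow> (nat \<Rightarrow> nat \<Rightarrow> 'k) \<Rightarrow> 'k mat" where
  "gram_mat k s c f = mat k k (\<lambda>(\<alpha>, \<beta>). \<Sum>j<s. c j * f j \<alpha> * f j \<beta>)"

lemma gram_mat_carrier [simp]: "gram_mat k s c f \<in> carrier_mat k k"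
  by (simp add: gram_mat_def)

lemma gram_mat_mult_vec:
  assumes "v \<in> carrier_vec k" "\<alpha> < k"
  shows "(gram_mat k s c f *\<^sub>v v) $ \<alpha> = (\<Sum>j<s. f j \<alpha> * (c j * (\<Sum>\<beta><k. f j \<beta> * v $ \<beta>)))"
proof -
  have "(gram_mat k s c f *\<^sub>v v) $ \<alpha> = (\<Sum>\<beta><k. \<Sum>j<s. f j \<alpha> * (c j * (f j \<beta> * v $ \<beta>)))"
    using assms
    by (simp add: gram_mat_def scalar_prod_def atLeast0LessThan sum_distrib_left sum_distrib_right
        ac_simps)
  then show ?thesis
    by (simp add: sum.swap[of _ "{..<k}"] sum_distrib_left)
qed

lemma gram_normal_equations_solvable:
  fixes f :: "nat \<Rightarrow> nat \<Rightarrow> 'k::field"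
  assumes "det (gram_mat k s c f) \<noteq> 0"
  shows "\<exists>x. \<forall>\<alpha><k. (\<Sum>j<s. f j \<alpha> * (c j * (\<Sum>\<beta><k. f j \<beta> * x \<beta>) - w j)) = 0"
proof -
  let ?G = "gram_mat k s c f"
  define b where "b = vec k (\<lambda>\<alpha>. \<Sum>j<s. f j \<alpha> * w j)"
  obtain B where B: "B \<in> carrier_mat k k" "?G * B = 1\<^sub>m k"
    using det_non_zero_imp_unit[OF gram_mat_carrier assms, of "()"]
    by (auto simp: Units_def ring_mat_def)
  have b: "b \<in> carrier_vec k" by (simp add: b_def)
  then have v: "B *\<^sub>v b \<in> carrier_vec k" using B(1) by simp
  have "?G *\<^sub>v (B *\<^sub>v b) = b"
    using B b by (simp flip: assoc_mult_mat_vec[OF gram_mat_carrier])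
  then have "(\<Sum>j<s. f j \<alpha> * (c j * (\<Sum>\<beta><k. f j \<beta> * (B *\<^sub>v b) $ \<beta>))) = (\<Sum>j<s. f j \<alpha> * w j)"
    if "\<alpha> < k" for \<alpha>
    using gram_mat_mult_vec[OF v that, of s c f] that by (simp add: b_def)
  then show ?thesis
    by (intro exI[of _ "\<lambda>\<beta>. (B *\<^sub>v b) $ \<beta>"]) (simp add: right_diff_distrib sum_subtractf)
qed

text \<open>
  For as many functions as points the factor $V$ is square, and it inherits invertibility from
  $V^T D V$.
\<close>
lemma gram_square_separates_points:
  fixes f :: "nat \<Rightarrow> nat \<Rightarrow> 'k::field"
  assumes det: "det (gram_mat s s c f) \<noteq> 0"
    and orth: "\<And>\<alpha>. \<alpha> < s \<Longrightarrow> (\<Sum>j<s. f j \<alpha> * y j) = 0"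
    and "j < s"
  shows "y j = 0"
proof -
  define V where "V = mat s s (\<lambda>(\<alpha>, j). f j \<alpha>)"
  define W where "W = mat s s (\<lambda>(j, \<beta>). c j * f j \<beta>)"
  have VW: "V \<in> carrier_mat s s" "W \<in> carrier_mat s s" by (auto simp: V_def W_def)
  have "gram_mat s s c f = V * W"
    by (rule eq_matI)
      (auto simp: gram_mat_def V_def W_def scalar_prod_def atLeast0LessThan ac_simps)
  then have "det V \<noteq> 0"
    using det det_mult[OF VW] by auto
  moreover have "V *\<^sub>v vec s y = 0\<^sub>v s"
    using orth by (intro eq_vecI) (auto simp: V_def scalar_prod_def atLeast0LessThan)
  ultimately have "vec s y = 0\<^sub>v s"
    using det_0_iff_vec_prod_zero_field[OF VW(1)] vec_carrier by blast
  then show ?thesis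
    using \<open>j < s\<close> by (metis index_vec index_zero_vec(1))
qed

text \<open>
  With positive weights and independent columns the Gram matrix is positive definite.
\<close>
lemma gram_det_nonzero_real:
  fixes f :: "nat \<Rightarrow> nat \<Rightarrow> real"
  assumes pos: "\<And>j. j < s \<Longrightarrow> 0 < c j"
    and indep: "\<And>x \<alpha>. (\<And>j. j < s \<Longrightarrow> (\<Sum>\<beta><k. f j \<beta> * x \<beta>) = 0) \<Longrightarrow> \<alpha> < k \<Longrightarrow> x \<alpha> = 0"
  shows "det (gram_mat k s c f) \<noteq> 0"
proof
  assume "det (gram_mat k s c f) = 0"
  then obtain v where v: "v \<in> carrier_vec k" "v \<noteq> 0\<^sub>v k" "gram_mat k s c f *\<^sub>v v = 0\<^sub>v k"
    using det_0_iff_vec_prod_zero_field[OF gram_mat_carrier] by blast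
  let ?u = "\<lambda>j. \<Sum>\<beta><k. f j \<beta> * v $ \<beta>"
  have "(\<Sum>j<s. f j \<alpha> * (c j * ?u j)) = 0" if "\<alpha> < k" for \<alpha>
    using gram_mat_mult_vec[OF v(1) that, of s c f] v(3) that by simp
  \<comment> \<open>The quadratic form of the Gram matrix at \<^term>\<open>v\<close> is a weighted sum of squares.\<close>
  then have "0 = (\<Sum>\<alpha><k. v $ \<alpha> * (\<Sum>j<s. f j \<alpha> * (c j * ?u j)))"
    by simp
  also have "\<dots> = (\<Sum>j<s. \<Sum>\<alpha><k. (c j * ?u j) * (f j \<alpha> * v $ \<alpha>))"
    unfolding sum_distrib_left[of "v $ _"]
    by (subst sum.swap) (intro sum.cong refl, simp only: ac_simps)
  also have "\<dots> = (\<Sum>j<s. c j * (?u j)\<^sup>2)"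
    unfolding sum_distrib_left[symmetric] by (simp add: power2_eq_square mult.assoc)
  finally have "(\<Sum>j<s. c j * (?u j)\<^sup>2) = 0" by simp
  moreover have "0 \<le> c j * (?u j)\<^sup>2" if "j < s" for j
    using pos[OF that] by simp
  ultimately have *: "c j * (?u j)\<^sup>2 = 0" if "j < s" for j
    using that by (subst (asm) sum_nonneg_eq_0_iff) auto
  have "?u j = 0" if "j < s" for j
    using *[OF that] pos[OF that] by simp
  then have "v $ \<alpha> = 0" if "\<alpha> < k" for \<alpha>
    using indep[of "\<lambda>\<beta>. v $ \<beta>"] that by blast
  then have "v = 0\<^sub>v k"
    using v(1) by (intro eq_vecI) auto
  with v(2) show False ..
qed

text \<open>
  Positivity makes no sense over \<^typ>\<open>'k\<close>. At points with natural number coordinates,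
  however, the determinant is the image of an integer, whose nonvanishing can be decided over the
  reals.
\<close>
lemma det_gram_of_nat:
  "det (gram_mat k s (\<lambda>j. of_nat (c j)) (\<lambda>j \<alpha>. of_nat (f j \<alpha>))) =
    (of_int (det (gram_mat k s (\<lambda>j. int (c j)) (\<lambda>j \<alpha>. int (f j \<alpha>)))) :: 'k::comm_ring_1)"
proof -
  have "gram_mat k s (\<lambda>j. of_nat (c j)) (\<lambda>j \<alpha>. of_nat (f j \<alpha>)) =
      map_mat (of_int :: int \<Rightarrow> 'k) (gram_mat k s (\<lambda>j. int (c j)) (\<lambda>j \<alpha>. int (f j \<alpha>)))"
    by (rule eq_matI) (auto simp: gram_mat_def)
  then show ?thesis by (simp only: of_int_hom.hom_det)
qed

lemma gram_det_nonzero_of_nat: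
  fixes f :: "nat \<Rightarrow> nat \<Rightarrow> nat"
  assumes pos: "\<And>j. j < s \<Longrightarrow> 0 < c j"
    and indep: "\<And>(x :: nat \<Rightarrow> real) \<alpha>.
      (\<And>j. j < s \<Longrightarrow> (\<Sum>\<beta><k. real (f j \<beta>) * x \<beta>) = 0) \<Longrightarrow> \<alpha> < k \<Longrightarrow> x \<alpha> = 0"
  shows "det (gram_mat k s (\<lambda>j. of_nat (c j)) (\<lambda>j \<alpha>. of_nat (f j \<alpha>))) \<noteq> (0 :: 'k::field_char_0)"
proof -
  have "det (gram_mat k s (\<lambda>j. real (c j)) (\<lambda>j \<alpha>. real (f j \<alpha>))) \<noteq> 0"
    using pos indep by (intro gram_det_nonzero_real) auto
  then show ?thesis
    unfolding det_gram_of_nat[where 'k = real] det_gram_of_nat[where 'k = 'k] by simp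
qed

text \<open>
  Combining the equations with the coefficients of the polynomial that vanishes at all nodes but
  one isolates a single unknown. The degree of that polynomial is less than \<^term>\<open>s\<close>
  because there are at most \<^term>\<open>s\<close> nodes.
\<close>
lemma vandermonde_columns_independent:
  fixes z x :: "nat \<Rightarrow> 'k::field"
  assumes inj: "inj_on z {..<k}" and "k \<le> s"
    and zero: "\<And>j. j < s \<Longrightarrow> (\<Sum>\<beta><k. z \<beta> ^ j * x \<beta>) = 0"
    and \<alpha>: "\<alpha> < k"
  shows "x \<alpha> = 0"
proof -
  define q where "q = (\<Prod>\<beta>\<in>{..<k} - {\<alpha>}. [:- z \<beta>, 1:])"
  have "Polynomial.degree q = k - 1"
    using \<alpha> by (simp add: q_def degree_prod_eq_sum_degree)
  then have deg: "Polynomial.degree q < s" using \<alpha> \<open>k \<le> s\<close> by simp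
  have q_zero: "poly q (z \<beta>) = 0" if "\<beta> < k" "\<beta> \<noteq> \<alpha>" for \<beta>
    using that by (auto simp: q_def poly_prod)
  have q_nonzero: "poly q (z \<alpha>) \<noteq> 0"
    using inj \<alpha> by (auto simp: q_def poly_prod inj_on_def)
  \<comment> \<open>The equations for the exponents up to the degree, weighted by the coefficients of \<^term>\<open>q\<close>.\<close>
  have "(\<Sum>\<beta><k. poly q (z \<beta>) * x \<beta>) =
      (\<Sum>j\<le>Polynomial.degree q. Polynomial.coeff q j * (\<Sum>\<beta><k. z \<beta> ^ j * x \<beta>))"
    unfolding poly_altdef sum_distrib_right sum_distrib_left
    by (subst sum.swap) (simp add: mult.assoc)
  also have "\<dots> = 0"
    using deg zero by (intro sum.neutral) auto
  finally have "(\<Sum>\<beta><k. poly q (z \<beta>) * x \<beta>) = 0" .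
  moreover have "(\<Sum>\<beta><k. poly q (z \<beta>) * x \<beta>) = poly q (z \<alpha>) * x \<alpha>"
    using \<alpha> q_zero by (subst sum.remove[of _ \<alpha>]) auto
  ultimately show ?thesis using q_nonzero by simp
qed


section \<open>Polynomial functions and Zariski open sets\<close>

text \<open>
  Working with the functions defined by polynomials, rather than with the polynomials, makes it
  possible to form a determinant over the field and still know that it defines an open set.
\<close>
definition polyfun :: "'v set \<Rightarrow> (('v \<Rightarrow> 'k::comm_ring_1) \<Rightarrow> 'k) \<Rightarrow> bool" where
  "polyfun I f \<longleftrightarrow> (\<exists>p\<in>mpolys I. \<forall>a. mpoly_eval a p = f a)"

lemma polyfun_const: "polyfun I (\<lambda>_. c)"
  unfolding polyfun_def by (intro bexI[of _ "mconst c"]) auto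

lemma polyfun_var: "v \<in> I \<Longrightarrow> polyfun I (\<lambda>a. a v)"
  unfolding polyfun_def by (intro bexI[of _ "mvar v"]) auto

lemma polyfun_add: "polyfun I f \<Longrightarrow> polyfun I g \<Longrightarrow> polyfun I (\<lambda>a. f a + g a)"
  unfolding polyfun_def by (metis mpoly_eval_add mpolys_add)

lemma polyfun_mult: "polyfun I f \<Longrightarrow> polyfun I g \<Longrightarrow> polyfun I (\<lambda>a. f a * g a)"
  unfolding polyfun_def by (metis mpoly_eval_mult mpolys_mult)

lemma polyfun_power: "polyfun I f \<Longrightarrow> polyfun I (\<lambda>a. f a ^ k)"
  by (induction k) (auto intro: polyfun_const polyfun_mult)

lemma polyfun_sum: "(\<And>x. x \<in> X \<Longrightarrow> polyfun I (f x)) \<Longrightarrow> polyfun I (\<lambda>a. \<Sum>x\<in>X. f x a)"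
  by (induction X rule: infinite_finite_induct) (auto intro: polyfun_const polyfun_add)

lemma polyfun_prod: "(\<And>x. x \<in> X \<Longrightarrow> polyfun I (f x)) \<Longrightarrow> polyfun I (\<lambda>a. \<Prod>x\<in>X. f x a)"
  by (induction X rule: infinite_finite_induct) (auto intro: polyfun_const polyfun_mult)

lemma polyfun_det:
  assumes "\<And>\<alpha> \<beta>. \<alpha> < k \<Longrightarrow> \<beta> < k \<Longrightarrow> polyfun I (\<lambda>a. f a \<alpha> \<beta>)"
  shows "polyfun I (\<lambda>a. det (mat k k (\<lambda>(\<alpha>, \<beta>). f a \<alpha> \<beta>)))"
proof -
  have "polyfun I (\<lambda>a. \<Sum>p | p permutes {0..<k}. signof p * (\<Prod>\<alpha>=0..<k. f a \<alpha> (p \<alpha>)))"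
  proof (intro polyfun_sum polyfun_mult polyfun_const polyfun_prod)
    fix p \<alpha> assume "p \<in> {p. p permutes {0..<k}}" "\<alpha> \<in> {0..<k}"
    then have "\<alpha> < k" "p \<alpha> < k"
      using permutes_in_image[of p "{0..<k}" \<alpha>] by auto
    then show "polyfun I (\<lambda>a. f a \<alpha> (p \<alpha>))" by (rule assms)
  qed
  moreover have "det (mat k k (\<lambda>(\<alpha>, \<beta>). f a \<alpha> \<beta>)) =
      (\<Sum>p | p permutes {0..<k}. signof p * (\<Prod>\<alpha>=0..<k. f a \<alpha> (p \<alpha>)))" for a
  proof -
    have "p \<alpha> < k" if "p permutes {0..<k}" "\<alpha> < k" for p \<alpha>
      using permutes_in_image[OF that(1), of \<alpha>] that(2) by simp
    then show ?thesis
      by (subst det_def'[of _ k]) (auto intro!: sum.cong prod.cong arg_cong2[where f = "(*)"])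
  qed
  ultimately show ?thesis by simp
qed

lemma zariski_open_nonvanishing:
  assumes "polyfun I g"
  shows "zariski_open I {a \<in> I \<rightarrow>\<^sub>E UNIV. g a \<noteq> 0}"
proof -
  obtain p where "p \<in> mpolys I" "\<And>a. mpoly_eval a p = g a"
    using assms by (auto simp: polyfun_def)
  then show ?thesis
    unfolding zariski_open_def zariski_closed_def by (intro conjI exI[of _ "{p}"]) auto
qed


section \<open>General points\<close>

text \<open>
  Unique factorization: the exponents are recovered as multiplicities of the primes.
\<close>
lemma prime_monomials_distinct:
  assumes "\<And>v. prime (y v :: nat)" "inj y"
  shows "inj (monval y)"
proof (rule injI, rule poly_mapping_eqI)
  have *: "multiplicity (y w) (monval y m) = lookup m w" for m w
  proof -
    have "monval y m = (\<Prod>p\<in>y ` keys m. p ^ lookup m (inv_into UNIV y p))"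
      unfolding monval_def using assms(2) by (subst prod.reindex) (auto simp: inj_on_def)
    then have "multiplicity (y w) (monval y m) =
        (if y w \<in> y ` keys m then lookup m (inv_into UNIV y (y w)) else 0)"
      using assms(1) by (simp only:) (intro multiplicity_prod_prime_powers, auto)
    then show ?thesis
      using assms(2) by (auto simp: in_keys_iff inj_image_mem_iff)
  qed
  fix m m' w assume "monval y m = monval y m'"
  then show "lookup m w = lookup m' w" using *[of w m] *[of w m'] by simp
qed

lemma sum_mpoly_eval_zero:
  assumes "\<And>m. m \<in> keys q \<Longrightarrow> (\<Sum>j<s. monval (a j) m * y j) = 0"
  shows "(\<Sum>j<s. mpoly_eval (a j) q * y j) = 0"
proof -
  have "(\<Sum>j<s. mpoly_eval (a j) q * y j) =
      (\<Sum>m\<in>keys q. lookup q m * (\<Sum>j<s. monval (a j) m * y j))"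
    unfolding mpoly_eval_eq_linext linext_def sum_distrib_right sum_distrib_left
    by (subst sum.swap) (simp add: mult.assoc)
  then show ?thesis using assms by simp
qed

text \<open>
  The Gram matrix of monomials \<^term>\<open>ms\<close> gives a solution that is correct when tested
  against these monomials. If they are all monomials of the degree, there is nothing more to test. If
  there are as many of them as points, the residual vanishes at every point, and so is orthogonal
  to all forms.
\<close>
lemma normal_equations_if_gram_nonsingular:
  fixes a :: "nat \<Rightarrow> 'v \<Rightarrow> 'k::field"
  assumes det: "det (gram_mat k s c (\<lambda>j \<alpha>. monval (a j) (ms \<alpha>))) \<noteq> 0"
    and ms: "\<And>\<alpha>. \<alpha> < k \<Longrightarrow> keys (ms \<alpha>) \<subseteq> V \<and> mdeg (ms \<alpha>) = i"
    and full: "k = s \<or> {m. keys m \<subseteq> V \<and> mdeg m = i} \<subseteq> ms ` {..<k}"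
  shows "\<exists>p\<in>homogeneous_part V i. \<forall>q\<in>homogeneous_part V i.
    (\<Sum>j<s. mpoly_eval (a j) q * (c j * mpoly_eval (a j) p - w j)) = 0"
proof -
  obtain x where x: "\<And>\<alpha>. \<alpha> < k \<Longrightarrow> (\<Sum>j<s. monval (a j) (ms \<alpha>) *
      (c j * (\<Sum>\<beta><k. monval (a j) (ms \<beta>) * x \<beta>) - w j)) = 0"
    using gram_normal_equations_solvable[OF det] by blast
  define p where "p = (\<Sum>\<beta><k. single (ms \<beta>) (x \<beta>))"
  have p: "p \<in> homogeneous_part V i"
    unfolding p_def using ms
    by (intro homogeneous_sum homogeneous_single) auto
  have ev_p: "mpoly_eval (a j) p = (\<Sum>\<beta><k. monval (a j) (ms \<beta>) * x \<beta>)" for j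
    by (simp add: p_def mpoly_eval_sum mult.commute)
  define r where "r j = c j * mpoly_eval (a j) p - w j" for j
  have r: "(\<Sum>j<s. monval (a j) (ms \<alpha>) * r j) = 0" if "\<alpha> < k" for \<alpha>
    using x[OF that] by (simp add: r_def ev_p)
  have "(\<Sum>j<s. mpoly_eval (a j) q * r j) = 0" if q: "q \<in> homogeneous_part V i" for q
    using full
  proof
    assume [simp]: "k = s"
    have "r j = 0" if "j < s" for j
      using gram_square_separates_points[OF det[unfolded \<open>k = s\<close>] _ that] r by simp
    then show ?thesis by simp
  next
    assume all: "{m. keys m \<subseteq> V \<and> mdeg m = i} \<subseteq> ms ` {..<k}"
    show ?thesis
    proof (rule sum_mpoly_eval_zero)
      fix m assume "m \<in> keys q"
      then have "keys m \<subseteq> V \<and> mdeg m = i"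
        using q by (auto simp: homogeneous_part_def mpolys_def)
      then have "m \<in> ms ` {..<k}" using all by blast
      then show "(\<Sum>j<s. monval (a j) m * r j) = 0" using r by auto
    qed
  qed
  with p show ?thesis by (auto simp: r_def)
qed

text \<open>
  Selects $\min(s, |M|)$ elements; in the two cases of the last condition the monomials separate the
  points or exhaust the degree.
\<close>
lemma enumerate_subset_of_card_le:
  obtains k and ms :: "nat \<Rightarrow> 'm" where
    "inj_on ms {..<k}" "ms ` {..<k} \<subseteq> M" "k \<le> s" "k = s \<or> M \<subseteq> ms ` {..<k}"
proof -
  obtain T where T: "finite T" "T \<subseteq> M" "card T \<le> s" "card T = s \<or> T = M"
  proof (cases "finite M \<and> card M \<le> s")
    case True
    then show ?thesis using that[of M] by simp
  next
    case False
    then obtain T where "finite T" "T \<subseteq> M" "card T = s"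
      by (metis infinite_arbitrarily_large nat_le_linear obtain_subset_with_card_n finite_subset)
    then show ?thesis using that[of T] by simp
  qed
  obtain ms where "bij_betw ms {0..<card T} T"
    using ex_bij_betw_nat_finite[OF T(1)] by blast
  then have "inj_on ms {..<card T}" "ms ` {..<card T} = T"
    by (auto simp: bij_betw_def atLeast0LessThan)
  then show ?thesis using that[of ms "card T"] T by auto
qed

text \<open>
  The linear forms whose coefficient vectors are the powers $(y_0^j, \ldots, y_{n-1}^j)$. A monomial
  takes the value $(y^m)^j$ there, so the values of monomials form a Vandermonde matrix with nodes
  $y^m$.
\<close>
definition power_point :: "nat \<Rightarrow> nat \<Rightarrow> (nat \<Rightarrow> nat) \<Rightarrow> nat \<times> nat \<Rightarrow> 'k::semiring_1" where
  "power_point n s y = (\<lambda>(j, v)\<in>{..<s} \<times> {..<n}. of_nat (y v ^ j))"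

text \<open>
  The determinant of the Gram matrix of $\min(s, N)$ monomials, $N$ being their number in degree
  \<^term>\<open>i\<close>, is the required polynomial function of the coefficients. At the powers of a
  vector of primes it is nonzero, by positivity and the Vandermonde argument. The point is the same
  for all \<^term>\<open>i\<close> and \<^term>\<open>e\<close>, so finitely many such conditions can be imposed at once.
\<close>
lemma generic_normal_equations:
  assumes "0 < n" and y: "\<And>v. prime (y v :: nat)" "inj y"
  obtains g :: "(nat \<times> nat \<Rightarrow> 'k::field_char_0) \<Rightarrow> 'k" where
    "polyfun ({..<s} \<times> {..<n}) g" "g (power_point n s y) \<noteq> 0"
    "\<And>a w. g a \<noteq> 0 \<Longrightarrow> \<exists>p\<in>homogeneous_part {..<n} i. \<forall>q\<in>homogeneous_part {..<n} i.
      (\<Sum>j<s. mpoly_eval (form_point n a j) q *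
        (a (j, 0) ^ e * mpoly_eval (form_point n a j) p - w j)) = 0"
proof -
  let ?I = "{..<s} \<times> {..<n}" and ?M = "{m. keys m \<subseteq> {..<n} \<and> mdeg m = i}"
  obtain k and ms :: "nat \<Rightarrow> nat \<Rightarrow>\<^sub>0 nat" where ms: "inj_on ms {..<k}" "ms ` {..<k} \<subseteq> ?M"
    and k: "k \<le> s" "k = s \<or> ?M \<subseteq> ms ` {..<k}"
    by (rule enumerate_subset_of_card_le)
  have ms_vars: "keys (ms \<alpha>) \<subseteq> {..<n}" "mdeg (ms \<alpha>) = i" if "\<alpha> < k" for \<alpha>
    using ms(2) that by auto
  define g :: "(nat \<times> nat \<Rightarrow> 'k) \<Rightarrow> 'k" where
    "g a = det (gram_mat k s (\<lambda>j. a (j, 0) ^ e) (\<lambda>j \<alpha>. monval (form_point n a j) (ms \<alpha>)))" for a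
  have mon: "polyfun ?I (\<lambda>a :: nat \<times> nat \<Rightarrow> 'k. monval (form_point n a j) (ms \<alpha>))"
    if "j < s" "\<alpha> < k" for j \<alpha>
  proof -
    have "monval (form_point n a j) (ms \<alpha>) = (\<Prod>v\<in>keys (ms \<alpha>). a (j, v) ^ lookup (ms \<alpha>) v)"
      for a :: "nat \<times> nat \<Rightarrow> 'k"
      unfolding monval_def using ms_vars(1)[OF that(2)]
      by (intro prod.cong) (auto simp: coeff_point_def)
    then show ?thesis
      using ms_vars(1)[OF that(2)] that(1)
      by (auto intro!: polyfun_prod polyfun_power polyfun_var)
  qed
  have "polyfun ?I g"
    unfolding g_def gram_mat_def using \<open>0 < n\<close>
    by (intro polyfun_det polyfun_sum polyfun_mult polyfun_power polyfun_var mon) auto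
  moreover have "g (power_point n s y) \<noteq> 0"
  proof -
    let ?z = "\<lambda>\<alpha>. monval y (ms \<alpha>)"
    have point: "monval (form_point n (power_point n s y) j) (ms \<alpha>) = (of_nat (?z \<alpha> ^ j) :: 'k)"
      if "j < s" "\<alpha> < k" for j \<alpha>
    proof -
      have "monval (form_point n (power_point n s y) j) (ms \<alpha>) =
          monval (\<lambda>v. of_nat (y v) ^ j :: 'k) (ms \<alpha>)"
        using ms_vars(1)[OF that(2)] that(1)
        by (intro monval_cong) (auto simp: coeff_point_def power_point_def)
      also have "\<dots> = of_nat (?z \<alpha> ^ j)"
        by (simp add: monval_fun_power monval_of_nat)
      finally show ?thesis .
    qed
    have base: "power_point n s y (j, 0) = (of_nat (y 0 ^ j) :: 'k)" if "j < s" for j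
      using that \<open>0 < n\<close> by (simp add: power_point_def)
    have "g (power_point n s y) =
        det (gram_mat k s (\<lambda>j. of_nat ((y 0 ^ j) ^ e)) (\<lambda>j \<alpha>. of_nat (?z \<alpha> ^ j)))"
      unfolding g_def gram_mat_def
      by (intro arg_cong[where f = det] eq_matI) (auto simp: point base intro!: sum.cong)
    also have "\<dots> \<noteq> 0"
    proof (rule gram_det_nonzero_of_nat)
      show "0 < (y 0 ^ j) ^ e" for j
        using prime_gt_0_nat[OF y(1)[of 0]] by simp
      fix x :: "nat \<Rightarrow> real" and \<alpha>
      assume zero: "\<And>j. j < s \<Longrightarrow> (\<Sum>\<beta><k. real (?z \<beta> ^ j) * x \<beta>) = 0" and "\<alpha> < k"
      have "inj_on (\<lambda>\<beta>. real (?z \<beta>)) {..<k}"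
        using ms(1) prime_monomials_distinct[OF y] by (auto simp: inj_on_def)
      from vandermonde_columns_independent[OF this k(1) _ \<open>\<alpha> < k\<close>] zero
      show "x \<alpha> = 0" by simp
    qed
    finally show ?thesis .
  qed
  moreover have "\<exists>p\<in>homogeneous_part {..<n} i. \<forall>q\<in>homogeneous_part {..<n} i.
      (\<Sum>j<s. mpoly_eval (form_point n a j) q *
        (a (j, 0) ^ e * mpoly_eval (form_point n a j) p - w j)) = 0" if "g a \<noteq> 0" for a w
    using that k(2) ms_vars unfolding g_def
    by (intro normal_equations_if_gram_nonsingular) auto
  ultimately show ?thesis using that by blast
qed

theorem theorem5p4:
  fixes n d s :: nat
  assumes "2 \<le> n" and "1 \<le> d" and "1 \<le> s" and "s \<le> (d + n - 1) choose d"
  shows "holds_for_general ({..<s} \<times> {..<n})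
    (\<lambda>a :: nat \<times> nat \<Rightarrow> 'k::{alg_closed_field, field_char_0}.
      strong_lefschetz
        (macaulay_algebra n (power_sum_form n d s a))
        (macaulay_part n (power_sum_form n d s a)))"
proof -
  let ?I = "{..<s} \<times> {..<n}"
  have n: "0 < n" using assms(1) by simp
  define y where "y = enumerate {p :: nat. prime p}"
  have y: "prime (y v)" "inj y" for v
    using enumerate_in_set[OF primes_infinite] strict_mono_enumerate[OF primes_infinite]
    by (auto simp: y_def strict_mono_imp_inj_on)
  let ?solvable = "\<lambda>i (a :: nat \<times> nat \<Rightarrow> 'k). \<forall>w.
    \<exists>p\<in>homogeneous_part {..<n} i. \<forall>q\<in>homogeneous_part {..<n} i.
      (\<Sum>j<s. mpoly_eval (form_point n a j) q *
        (a (j, 0) ^ (d - 2 * i) * mpoly_eval (form_point n a j) p - w j)) = 0"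
  have "\<forall>i. \<exists>g. polyfun ?I g \<and> g (power_point n s y) \<noteq> 0 \<and> (\<forall>a. g a \<noteq> 0 \<longrightarrow> ?solvable i a)"
  proof
    fix i
    show "\<exists>g. polyfun ?I g \<and> g (power_point n s y) \<noteq> 0 \<and> (\<forall>a. g a \<noteq> 0 \<longrightarrow> ?solvable i a)"
      by (rule generic_normal_equations[OF n y, where 'k = 'k and i = i and e = "d - 2 * i"]) blast
  qed
  from choice[OF this] obtain g where g: "\<forall>i. polyfun ?I (g i) \<and>
      g i (power_point n s y) \<noteq> 0 \<and> (\<forall>a. g i a \<noteq> 0 \<longrightarrow> ?solvable i a)"
    by (rule exE)
  let ?U = "{a \<in> ?I \<rightarrow>\<^sub>E UNIV. (\<Prod>i\<le>d. g i a) \<noteq> 0}"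
  have "zariski_open ?I ?U"
    using g by (intro zariski_open_nonvanishing polyfun_prod) blast
  moreover have "power_point n s y \<in> ?U"
    using g by (auto simp: power_point_def[of n s y])
  moreover have "strong_lefschetz (macaulay_algebra n (power_sum_form n d s a))
      (macaulay_part n (power_sum_form n d s a))" if "a \<in> ?U" for a
  proof (rule strong_lefschetz_if_normal_equations[OF n])
    fix i and w :: "nat \<Rightarrow> 'k" assume "2 * i \<le> d"
    then have "g i a \<noteq> 0" using that by simp
    with g have "?solvable i a" by blast
    then show "\<exists>p\<in>homogeneous_part {..<n} i. \<forall>q\<in>homogeneous_part {..<n} i.
      (\<Sum>j<s. mpoly_eval (form_point n a j) q *
        (a (j, 0) ^ (d - 2 * i) * mpoly_eval (form_point n a j) p - w j)) = 0"
      by (rule spec)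
  qed
  ultimately show ?thesis
    unfolding holds_for_general_def by blast
qed

end
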